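(* Let $n \geq 1$ and let $\alpha = (a_1,a_2,\dots,a_n)$ be a displacement pattern, i.e. a sequence of integers with $a_1 \geq a_2 \geq \dots \geq a_n$. Then there exists a permutation $\pi \in S_n$ with displacement pattern $\alpha_\pi = \alpha$ if and only if the multiset $A = \{a_1+n, a_2+n, \dots, a_n+n\}$ is a perfect extremal multi Skolem set.
   Context: For a permutation $\pi \in S_n$ of $\{1,\dots,n\}$, its displacement pattern $\alpha_\pi$ is the multiset of differences $\{\pi(i)-i : 1 \leq i \leq n\}$ (with multiplicities) sorted in (weakly) decreasing order. A multiset $A = \{c_1,\dots,c_n\}$ of integers is a perfect multi Skolem set if all $c_i$ are positive and the set $\{1,2,\dots,2n\}$ can be partitioned into $n$ two-element subsets $\{s_i,t_i\}$ with $s_i - t_i = c_i$ for $i=1,\dots,n$. It is a perfect extremal multi Skolem set if in addition $\sum_{i=1}^n c_i = n^2$. *)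

theory Defs
  imports
    "HOL-Combinatorics.Permutations"
    "HOL-Library.Multiset"
    "HOL-Library.Disjoint_Sets"
begin

definition displacement_pattern :: "nat \<Rightarrow> (nat \<Rightarrow> nat) \<Rightarrow> int list" where
  "displacement_pattern n \<pi> =
     rev (sorted_list_of_multiset {# int (\<pi> i) - int i. i \<in># mset_set {1..n} #})"

text \<open>
  Here \<open>c\<close> is an enumeration of the multiset \<open>A\<close>. The blocks \<open>{s i, t i}\<close> form a partition
  as an indexed family, so distinct indices give disjoint blocks even where
  \<open>c\<close> takes the same value.
\<close>

definition perfect_multi_skolem_set :: "int multiset \<Rightarrow> bool" where
  "perfect_multi_skolem_set A \<longleftrightarrow>
     (\<forall>x \<in># A. x > 0) \<and>
     (\<exists>c s t :: nat \<Rightarrow> int.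
        A = {# c i. i \<in># mset_set {1..size A} #} \<and>
        (\<Union>i\<in>{1..size A}. {s i, t i}) = {1..2 * int (size A)} \<and>
        disjoint_family_on (\<lambda>i. {s i, t i}) {1..size A} \<and>
        (\<forall>i\<in>{1..size A}. card {s i, t i} = 2 \<and> s i - t i = c i))"

definition perfect_extremal_multi_skolem_set :: "int multiset \<Rightarrow> bool" where
  "perfect_extremal_multi_skolem_set A \<longleftrightarrow>
     perfect_multi_skolem_set A \<and> sum_mset A = (int (size A))\<^sup>2"

end

theory Submission
  imports Defs
begin

text \<open>
  A permutation \<open>\<pi>\<close> of \<open>{1..n}\<close> is the same thing as a pairing of the lower half \<open>{1..n}\<close> of
  \<open>{1..2 * n}\<close> with the upper half \<open>{n + 1..2 * n}\<close>: pair \<open>i\<close> with \<open>\<pi> i + n\<close>. The differences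
  of this pairing are the displacements of \<open>\<pi>\<close> shifted by \<open>n\<close>, they are positive, and they add
  up to \<open>n\<^sup>2\<close> because the displacements add up to \<open>0\<close>
  (\<open>permutation_imp_perfect_extremal\<close>).

  Conversely, extremality forces every pairing to be of this kind. All the \<open>s i\<close> and
  \<open>t i\<close> together sum to \<open>n * (2 * n + 1)\<close>. If the differences \<open>s i - t i\<close> sum to \<open>n\<^sup>2\<close>, then
  the \<open>t i\<close> sum to \<open>n * (n + 1) / 2\<close>, which is the least possible sum of \<open>n\<close> distinct
  positive integers and is attained by \<open>{1..n}\<close> only
  (\<open>positive_ints_minimal_sum_unique\<close>). So the \<open>t i\<close> fill the lower half, the \<open>s i\<close>
  the upper half, and \<open>t i \<mapsto> s i - n\<close> is the required permutation
  (\<open>perfect_extremal_imp_permutation\<close>).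
\<close>

lemma displacement_pattern_eq_iff:
  assumes "sorted_wrt (\<ge>) \<alpha>"
  shows "displacement_pattern n \<pi> = \<alpha> \<longleftrightarrow>
         {# int (\<pi> i) - int i. i \<in># mset_set {1..n} #} = mset \<alpha>" (is "_ \<longleftrightarrow> ?M = _")
proof
  assume "displacement_pattern n \<pi> = \<alpha>"
  then have "mset \<alpha> = mset (rev (sorted_list_of_multiset ?M))"
    by (simp add: displacement_pattern_def)
  then show "?M = mset \<alpha>" by simp
next
  assume M: "?M = mset \<alpha>"
  have "sorted (rev \<alpha>)"
    using assms by (simp add: sorted_wrt_rev)
  then have "sorted_list_of_multiset (mset \<alpha>) = rev \<alpha>"
    by (simp add: sorted_list_of_multiset_mset properties_for_sort)
  then show "displacement_pattern n \<pi> = \<alpha>"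
    using M by (simp add: displacement_pattern_def)
qed

text \<open>
  Exchange argument: \<open>T - {1..n}\<close> and \<open>{1..n} - T\<close> have equal size and equal sum, but every
  element of the former exceeds every element of the latter, so both are empty.
\<close>

lemma positive_ints_minimal_sum_unique:
  fixes T :: "int set"
  assumes fin: "finite T" and card: "card T = n" and pos: "\<forall>x\<in>T. x > 0"
    and sum: "\<Sum>T = \<Sum>{1..int n}"
  shows "T = {1..int n}"
proof -
  define U where "U = {1..int n}"
  have finU: "finite U" and cardU: "card U = n" by (auto simp: U_def)
  have "card (T - U) + card (T \<inter> U) = card T"
    using fin by (metis card_Diff_subset_Int add.commute card_Int_Diff finite_Int)
  moreover have "card (U - T) + card (T \<inter> U) = card U"
    using finU by (metis add.commute card_Int_Diff inf_commute)
  ultimately have cards: "card (T - U) = card (U - T)"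
    using card cardU by simp
  have "\<Sum>(T - U) + \<Sum>(T \<inter> U) = \<Sum>T"
    using fin by (metis add.commute sum.Int_Diff)
  moreover have "\<Sum>(U - T) + \<Sum>(T \<inter> U) = \<Sum>U"
    using finU by (metis add.commute inf_commute sum.Int_Diff)
  ultimately have sums: "\<Sum>(T - U) = \<Sum>(U - T)"
    using sum U_def by simp
  have "of_nat (card (T - U)) * (int n + 1) \<le> \<Sum>(T - U)"
    by (rule sum_bounded_below) (use pos in \<open>force simp: U_def\<close>)
  moreover have "\<Sum>(U - T) \<le> of_nat (card (U - T)) * int n"
    by (rule sum_bounded_above) (auto simp: U_def)
  ultimately have "int (card (T - U)) \<le> 0"
    using cards sums by (simp add: algebra_simps)
  then have "T - U = {}" using fin by simp
  then have "T \<subseteq> U" by blast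
  then show ?thesis
    using card_subset_eq[OF finU] card cardU by (simp add: U_def)
qed

lemma sum_int_atLeastAtMost: "2 * \<Sum>{1..int m} = int m * (int m + 1)"
proof (induction m)
  case (Suc m)
  have "{1..int (Suc m)} = insert (int m + 1) {1..int m}" by auto
  then show ?case using Suc by (simp add: algebra_simps)
qed simp

lemma permutation_imp_perfect_extremal:
  assumes perm: "\<pi> permutes {1..n}"
  shows "perfect_extremal_multi_skolem_set
           {# int (\<pi> i) - int i + int n. i \<in># mset_set {1..n} #}"
    (is "perfect_extremal_multi_skolem_set ?A")
proof -
  define s t where "s = (\<lambda>i. int (\<pi> i) + int n)" and "t = (\<lambda>i. int i)"
  have size: "size ?A = n" by simp
  have range: "1 \<le> \<pi> i \<and> \<pi> i \<le> n" if "i \<in> {1..n}" for i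
    using permutes_in_image[OF perm, of i] that by simp
  have inj: "\<pi> i = \<pi> j \<longleftrightarrow> i = j" for i j
    using permutes_inj[OF perm] by (auto dest: injD)
  have positive: "\<forall>x\<in>#?A. x > 0"
    using range by force
  have cover: "(\<Union>i\<in>{1..n}. {s i, t i}) = {1..2 * int n}"
  proof
    show "(\<Union>i\<in>{1..n}. {s i, t i}) \<subseteq> {1..2 * int n}"
      using range by (fastforce simp: s_def t_def)
    show "{1..2 * int n} \<subseteq> (\<Union>i\<in>{1..n}. {s i, t i})"
    proof
      fix x assume x: "x \<in> {1..2 * int n}"
      show "x \<in> (\<Union>i\<in>{1..n}. {s i, t i})"
      proof (cases "x \<le> int n")
        case True
        then have "nat x \<in> {1..n}" "x = t (nat x)" using x by (auto simp: t_def)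
        then show ?thesis by blast
      next
        case False
        then have "nat (x - int n) \<in> \<pi> ` {1..n}"
          using x permutes_image[OF perm] by auto
        then obtain i where "i \<in> {1..n}" "\<pi> i = nat (x - int n)" by force
        moreover from this have "x = s i" using False by (simp add: s_def)
        ultimately show ?thesis by blast
      qed
    qed
  qed
  have disjoint: "disjoint_family_on (\<lambda>i. {s i, t i}) {1..n}"
    unfolding disjoint_family_on_def
  proof (intro ballI impI)
    fix i j assume ij: "i \<in> {1..n}" "j \<in> {1..n}" "i \<noteq> j"
    then show "{s i, t i} \<inter> {s j, t j} = {}"
      using range[OF ij(1)] range[OF ij(2)] inj[of i j] by (auto simp: s_def t_def)
  qed
  have blocks: "\<forall>i\<in>{1..n}. card {s i, t i} = 2 \<and> s i - t i = int (\<pi> i) - int i + int n"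
  proof
    fix i assume "i \<in> {1..n}"
    then have "s i \<noteq> t i" using range[of i] by (simp add: s_def t_def)
    then show "card {s i, t i} = 2 \<and> s i - t i = int (\<pi> i) - int i + int n"
      by (simp add: s_def t_def)
  qed
  have "perfect_multi_skolem_set ?A"
    unfolding perfect_multi_skolem_set_def size
    by (intro conjI positive exI[of _ "\<lambda>i. int (\<pi> i) - int i + int n"] exI[of _ s] exI[of _ t]
        refl cover disjoint blocks)
  moreover have "sum_mset ?A = (int (size ?A))\<^sup>2"
  proof -
    have "(\<Sum>i\<in>{1..n}. int (\<pi> i)) = (\<Sum>i\<in>{1..n}. int i)"
      using sum.permute[OF perm, of int] by (simp add: o_def)
    then have "(\<Sum>i\<in>{1..n}. int (\<pi> i) - int i + int n) = int n * int n"
      by (simp add: sum.distrib sum_subtractf)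
    then show ?thesis
      by (simp add: sum_unfold_sum_mset[symmetric] power2_eq_square)
  qed
  ultimately show ?thesis
    by (simp add: perfect_extremal_multi_skolem_set_def)
qed

lemma perfect_extremal_imp_permutation:
  assumes ext: "perfect_extremal_multi_skolem_set A"
  obtains \<pi> where "\<pi> permutes {1..size A}"
    and "{# int (\<pi> i) - int i + int (size A). i \<in># mset_set {1..size A} #} = A"
proof -
  define n where "n = size A"
  define I where "I = {1..n}"
  have finI: "finite I" and cardI: "card I = n" by (auto simp: I_def)
  obtain c s t where A: "A = {# c i. i \<in># mset_set I #}"
    and cover: "(\<Union>i\<in>I. {s i, t i}) = {1..2 * int n}"
    and disjoint: "disjoint_family_on (\<lambda>i. {s i, t i}) I"
    and blocks: "\<forall>i\<in>I. card {s i, t i} = 2 \<and> s i - t i = c i"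
    using ext unfolding perfect_extremal_multi_skolem_set_def perfect_multi_skolem_set_def
      n_def I_def by auto
  have total: "sum_mset A = (int n)\<^sup>2"
    using ext by (simp add: perfect_extremal_multi_skolem_set_def n_def)
  have diff: "c i = s i - t i" and neq: "s i \<noteq> t i" if "i \<in> I" for i
    using blocks that by (auto simp: card_2_iff doubleton_eq_iff)
  have distinct: "s i \<noteq> s j \<and> t i \<noteq> t j \<and> s i \<noteq> t j" if "i \<in> I" "j \<in> I" "i \<noteq> j" for i j
    using disjoint that unfolding disjoint_family_on_def by blast
  have inj_s: "inj_on s I" and inj_t: "inj_on t I"
    using distinct by (meson inj_onI)+
  have disj: "s ` I \<inter> t ` I = {}"
    using distinct neq by blast
  have un: "s ` I \<union> t ` I = {1..2 * int n}"
    using cover by blast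

  have "(\<Sum>i\<in>I. s i) + (\<Sum>i\<in>I. t i) = \<Sum>{1..2 * int n}"
    using sum.union_disjoint[of "s ` I" "t ` I" "\<lambda>x. x"] finI disj un
    by (simp add: sum.reindex[OF inj_s] sum.reindex[OF inj_t])
  moreover have "(\<Sum>i\<in>I. s i) - (\<Sum>i\<in>I. t i) = int n * int n"
  proof -
    have "sum_mset A = (\<Sum>i\<in>I. s i - t i)"
      using A diff by (simp add: sum_unfold_sum_mset[symmetric])
    then show ?thesis using total by (simp add: sum_subtractf power2_eq_square)
  qed
  ultimately have "\<Sum>(t ` I) = \<Sum>{1..int n}"
    using sum_int_atLeastAtMost[of "2 * n"] sum_int_atLeastAtMost[of n]
    by (simp add: sum.reindex[OF inj_t] algebra_simps)
  moreover have "\<forall>x\<in>t ` I. x > 0"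
    using un by force
  ultimately have t_image: "t ` I = {1..int n}"
    using positive_ints_minimal_sum_unique[of "t ` I" n] finI
    by (simp add: card_image[OF inj_t] cardI)
  have s_image: "s ` I = {int n + 1..2 * int n}"
  proof -
    have "s ` I = {1..2 * int n} - {1..int n}"
      using disj un t_image by blast
    then show ?thesis by auto
  qed

  define p q where "p = (\<lambda>i. nat (t i))" and "q = (\<lambda>i. nat (s i - int n))"
  have t_bounds: "1 \<le> t i \<and> t i \<le> int n" and s_bounds: "int n + 1 \<le> s i \<and> s i \<le> 2 * int n"
    if "i \<in> I" for i
    using that t_image s_image by (metis atLeastAtMost_iff imageI)+
  have "inj_on p I"
    using inj_t t_bounds unfolding inj_on_def p_def
    by (metis nat_0_le order.trans zero_le_one)
  moreover have "p ` I \<subseteq> I"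
    using t_bounds by (force simp: p_def I_def)
  ultimately have p: "bij_betw p I I"
    using finI by (simp add: bij_betw_def endo_inj_surj)
  have "inj_on q I"
  proof (rule inj_onI)
    fix i j assume ij: "i \<in> I" "j \<in> I" and eq: "q i = q j"
    have "s i = s j"
      using eq s_bounds[OF ij(1)] s_bounds[OF ij(2)] by (simp add: q_def eq_nat_nat_iff)
    then show "i = j"
      using inj_onD[OF inj_s _ ij] by blast
  qed
  moreover have "q ` I \<subseteq> I"
    using s_bounds by (force simp: q_def I_def)
  ultimately have q: "bij_betw q I I"
    using finI by (simp add: bij_betw_def endo_inj_surj)

  define \<pi> where "\<pi> = (\<lambda>j. if j \<in> I then q (inv_into I p j) else j)"
  have \<pi>_p: "\<pi> (p i) = q i" if "i \<in> I" for i
    using that p by (simp add: \<pi>_def bij_betw_inv_into_left bij_betwE)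
  have "bij_betw (q \<circ> inv_into I p) I I"
    using bij_betw_trans[OF bij_betw_inv_into[OF p] q] .
  then have "bij_betw \<pi> I I"
    by (rule bij_betw_cong[THEN iffD1, rotated]) (simp add: \<pi>_def)
  then have perm: "\<pi> permutes I"
    by (rule bij_imp_permutes) (simp add: \<pi>_def)
  \<comment> \<open>Enumerate the points of \<open>I\<close> as \<open>p i\<close>: the block of \<open>i\<close> then yields the displacement of \<open>p i\<close>.\<close>
  have "image_mset p (mset_set I) = mset_set I"
    using p by (simp add: bij_betw_def image_mset_mset_set)
  then have "{# int (\<pi> j) - int j + int n. j \<in># mset_set I #} =
        {# int (\<pi> j) - int j + int n. j \<in># image_mset p (mset_set I) #}"
    by (rule arg_cong[OF sym])
  also have "\<dots> = {# int (\<pi> (p i)) - int (p i) + int n. i \<in># mset_set I #}"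
    by (simp add: image_mset.compositionality comp_def)
  also have "\<dots> = {# c i. i \<in># mset_set I #}"
  proof (rule image_mset_cong)
    fix i assume "i \<in># mset_set I"
    then have i: "i \<in> I" using finI by simp
    then show "int (\<pi> (p i)) - int (p i) + int n = c i"
      using \<pi>_p[OF i] diff[OF i] t_bounds[OF i] s_bounds[OF i] by (simp add: p_def q_def)
  qed
  finally have "{# int (\<pi> j) - int j + int n. j \<in># mset_set I #} = A"
    using A by simp
  with perm show thesis
    unfolding I_def n_def by (rule that)
qed

theorem theorem15:
  fixes n :: nat and \<alpha> :: "int list"
  assumes "n \<ge> 1"
    and "length \<alpha> = n"
    and "sorted_wrt (\<ge>) \<alpha>"
  shows "(\<exists>\<pi>. \<pi> permutes {1..n} \<and> displacement_pattern n \<pi> = \<alpha>) \<longleftrightarrow>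
         perfect_extremal_multi_skolem_set {# a + int n. a \<in># mset \<alpha> #}"
    (is "?L \<longleftrightarrow> perfect_extremal_multi_skolem_set ?A")
proof
  assume ?L
  then obtain \<pi> where perm: "\<pi> permutes {1..n}"
    and \<alpha>: "{# int (\<pi> i) - int i. i \<in># mset_set {1..n} #} = mset \<alpha>"
    using displacement_pattern_eq_iff[OF assms(3)] by blast
  have "?A = {# int (\<pi> i) - int i + int n. i \<in># mset_set {1..n} #}"
    by (simp add: \<alpha>[symmetric] image_mset.compositionality comp_def)
  then show "perfect_extremal_multi_skolem_set ?A"
    using permutation_imp_perfect_extremal[OF perm] by simp
next
  assume "perfect_extremal_multi_skolem_set ?A"
  moreover have "size ?A = n" using assms(2) by simp
  ultimately obtain \<pi> where perm: "\<pi> permutes {1..n}"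
    and A: "{# int (\<pi> i) - int i + int n. i \<in># mset_set {1..n} #} = ?A"
    by (elim perfect_extremal_imp_permutation) simp
  have "image_mset (\<lambda>a. a - int n) {# int (\<pi> i) - int i + int n. i \<in># mset_set {1..n} #} =
        image_mset (\<lambda>a. a - int n) ?A"
    by (simp only: A)
  then have "{# int (\<pi> i) - int i. i \<in># mset_set {1..n} #} = mset \<alpha>"
    by (simp add: image_mset.compositionality comp_def)
  then show ?L
    using perm displacement_pattern_eq_iff[OF assms(3)] by blast
qed

end
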